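(* For $n\ge1$ and $r\ge1$, the number of connected skew diagrams (counted up to translation, i.e. as parallelogram polyominoes) of perimeter $2n+2$ and rank $r$ equals \[2^{\,n+1-2r}\binom{n-1}{2r-2}C_{r-1}.\]
   Context: For partitions $\mu\subseteq\lambda$, the skew diagram $\lambda/\mu$ is the set of cells $(i,j)$ (row $i$, column $j$, English convention, rows numbered downwards) with $\mu_i<j\le\lambda_i$. It is connected if its cells form an edge-connected nonempty set; connected skew diagrams, up to translation, are exactly the parallelogram polyominoes. Its perimeter is its boundary length, i.e. $2\times$(number of nonempty rows + number of nonempty columns). A cell $(i,j)$ of $\lambda/\mu$ is an outside top corner if neither $(i-1,j)$ nor $(i,j-1)$ lies in $\lambda/\mu$; it is an inside top corner if both $(i-1,j)$ and $(i,j-1)$ lie in $\lambda/\mu$ but $(i-1,j-1)$ does not. The diagonal starting at a cell $(i,j)$ is the set of cells $(i+t,j+t)$, $t\ge0$, that lie in $\lambda/\mu$ for all $t'\le t$. The rank of $\lambda/\mu$ is the total number of cells on diagonals starting at outside top corners minus the total number of cells on diagonals starting at inside top corners. $C_m=\frac{1}{m+1}\binom{2m}{m}$ is the Catalan number. *)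

theory Defs
  imports Complex_Main "HOL-Library.Product_Plus"
begin

(* A partition is given by its parts p 1 \<ge> p 2 \<ge> ..., finitely many of them nonzero;
   the value p 0 plays no role. *)
definition is_partition :: "(nat \<Rightarrow> nat) \<Rightarrow> bool" where
  "is_partition p \<longleftrightarrow>
     (\<forall>i j. 1 \<le> i \<longrightarrow> i \<le> j \<longrightarrow> p j \<le> p i) \<and> finite {i. 1 \<le> i \<and> p i \<noteq> 0}"

definition part_contained :: "(nat \<Rightarrow> nat) \<Rightarrow> (nat \<Rightarrow> nat) \<Rightarrow> bool" where
  "part_contained mu lam \<longleftrightarrow> (\<forall>i\<ge>1. mu i \<le> lam i)"

(* Cells are (row, column), rows numbered downwards. Integer coordinates make translations total
   and let i - 1, j - 1 leave the positive quadrant. *)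
type_synonym cell = "int \<times> int"

definition skew_cells :: "(nat \<Rightarrow> nat) \<Rightarrow> (nat \<Rightarrow> nat) \<Rightarrow> cell set" where
  "skew_cells lam mu = {(int i, int j) | i j. 1 \<le> i \<and> mu i < j \<and> j \<le> lam i}"

definition is_skew_diagram :: "cell set \<Rightarrow> bool" where
  "is_skew_diagram S \<longleftrightarrow>
     (\<exists>lam mu. is_partition lam \<and> is_partition mu \<and> part_contained mu lam \<and> S = skew_cells lam mu)"

definition edge_adjacent :: "cell \<Rightarrow> cell \<Rightarrow> bool" where
  "edge_adjacent c d \<longleftrightarrow> \<bar>fst c - fst d\<bar> + \<bar>snd c - snd d\<bar> = 1"

definition edge_connected :: "cell set \<Rightarrow> bool" where
  "edge_connected S \<longleftrightarrow>
     S \<noteq> {} \<and> (\<forall>c\<in>S. \<forall>d\<in>S. (c, d) \<in> {(x, y). x \<in> S \<and> y \<in> S \<and> edge_adjacent x y}\<^sup>*)"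

definition perimeter :: "cell set \<Rightarrow> nat" where
  "perimeter S = 2 * (card (fst ` S) + card (snd ` S))"

definition outside_top_corners :: "cell set \<Rightarrow> cell set" where
  "outside_top_corners S = {(i, j). (i, j) \<in> S \<and> (i - 1, j) \<notin> S \<and> (i, j - 1) \<notin> S}"

definition inside_top_corners :: "cell set \<Rightarrow> cell set" where
  "inside_top_corners S =
     {(i, j). (i, j) \<in> S \<and> (i - 1, j) \<in> S \<and> (i, j - 1) \<in> S \<and> (i - 1, j - 1) \<notin> S}"

definition diagonal_from :: "cell set \<Rightarrow> cell \<Rightarrow> cell set" where
  "diagonal_from S c =
     {(fst c + int t, snd c + int t) | t. \<forall>t'\<le>t. (fst c + int t', snd c + int t') \<in> S}"

definition skew_rank :: "cell set \<Rightarrow> int" where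
  "skew_rank S =
     (\<Sum>c\<in>outside_top_corners S. int (card (diagonal_from S c)))
     - (\<Sum>c\<in>inside_top_corners S. int (card (diagonal_from S c)))"

definition translation_rel :: "(cell set \<times> cell set) set" where
  "translation_rel = {(S, T). \<exists>v. T = (+) v ` S}"

(* Translation classes of connected skew diagrams, i.e. parallelogram polyominoes. A class contains
   all integer translates; perimeter and rank are invariant under translation. *)
definition parallelogram_polyominoes :: "nat \<Rightarrow> int \<Rightarrow> cell set set set" where
  "parallelogram_polyominoes p r =
     {S. is_skew_diagram S \<and> edge_connected S \<and> perimeter S = p \<and> skew_rank S = r}
       // translation_rel"

definition catalan :: "nat \<Rightarrow> real" where
  "catalan m = 1 / (real m + 1) * real ((2 * m) choose m)"

end

theory Submission
  imports Defs
begin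

text \<open>
  A polyomino with \<open>n\<close> diagonals is bounded by two lattice paths of \<open>n + 1\<close> steps from its bottom left
  to its top right corner. Reading the paths simultaneously, their distance, which is the number
  \<open>h\<^sub>k\<close> of cells on the \<open>k\<close>-th diagonal, changes by \<open>1\<close>, \<open>-1\<close> or, in two ways, by \<open>0\<close>. Apart from
  the first and the last step this is a Motzkin path of length \<open>n - 1\<close> with two colours of level
  steps. An outside top corner is a step up followed by a step right of the upper path and
  an inside one the reverse, so if \<open>u\<^sub>k\<close> indicates the steps up of the upper path, the rank
  is \<open>\<Sum>k. h\<^sub>k (u\<^sub>k - u\<^sub>k\<^sub>+\<^sub>1) = \<Sum>k. u\<^sub>k (h\<^sub>k - h\<^sub>k\<^sub>-\<^sub>1)\<close>, the number of steps that increase the distance.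
  Hence the rank is \<open>r\<close> iff the Motzkin path has \<open>r - 1\<close> up steps. Such paths are counted through
  the ballot numbers. Diagonals and boundary paths are read off an arbitrary connected skew diagram
  using that skew diagrams are the finite sets convex for the product order.
\<close>

section \<open>Skew diagrams as order-convex sets\<close>

definition order_convex :: "cell set \<Rightarrow> bool" where
  "order_convex S \<longleftrightarrow> (\<forall>i j x y i' j'. (i, j) \<in> S \<longrightarrow> (i', j') \<in> S \<longrightarrow>
     i \<le> x \<longrightarrow> x \<le> i' \<longrightarrow> j \<le> y \<longrightarrow> y \<le> j' \<longrightarrow> (x, y) \<in> S)"

lemma order_convexD:
  "order_convex S \<Longrightarrow> (i, j) \<in> S \<Longrightarrow> (i', j') \<in> S \<Longrightarrow> i \<le> x \<Longrightarrow> x \<le> i' \<Longrightarrow> j \<le> y \<Longrightarrow> y \<le> j'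
     \<Longrightarrow> (x, y) \<in> S"
  unfolding order_convex_def by blast

lemma skew_diagram_finite:
  assumes "is_skew_diagram S"
  shows "finite S"
proof -
  obtain lam mu where l: "is_partition lam" and S: "S = skew_cells lam mu"
    using assms unfolding is_skew_diagram_def by blast
  have "S \<subseteq> (\<lambda>(i, j). (int i, int j)) ` (SIGMA i:{i. 1 \<le> i \<and> lam i \<noteq> 0}. {..lam i})"
    unfolding S skew_cells_def by force
  moreover have "finite (SIGMA i:{i. 1 \<le> i \<and> lam i \<noteq> 0}. {..lam i})"
    using l unfolding is_partition_def by (intro finite_SigmaI) auto
  ultimately show ?thesis
    by (meson finite_imageI finite_subset)
qed

text \<open>Both partitions weakly decrease: moving down from the first cell does not raise
  \<open>mu\<close>, and moving up from the second does not lower \<open>lam\<close>.\<close>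

lemma skew_diagram_order_convex:
  assumes "is_skew_diagram S"
  shows "order_convex S"
proof -
  obtain lam mu where l: "is_partition lam" and m: "is_partition mu" and S: "S = skew_cells lam mu"
    using assms unfolding is_skew_diagram_def by blast
  show ?thesis
    unfolding order_convex_def
  proof (intro allI impI)
    fix i j x y i' j' :: int
    assume a: "(i, j) \<in> S" and b: "(i', j') \<in> S" and le: "i \<le> x" "x \<le> i'" "j \<le> y" "y \<le> j'"
    from a obtain k s where ks: "i = int k" "j = int s" "1 \<le> k" "mu k < s"
      unfolding S skew_cells_def by blast
    from b obtain k' s' where ks': "i' = int k'" "j' = int s'" "s' \<le> lam k'"
      unfolding S skew_cells_def by blast
    define u v where "u = nat x" and "v = nat y"
    have xy: "x = int u" "y = int v" "k \<le> u" "u \<le> k'" "s \<le> v" "v \<le> s'"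
      using le ks ks' by (auto simp: u_def v_def)
    have "mu u \<le> mu k" "lam k' \<le> lam u"
      using l m xy ks(3) unfolding is_partition_def by (meson order_trans)+
    then show "(x, y) \<in> S"
      using xy ks ks' unfolding S skew_cells_def by auto
  qed
qed

text \<open>Lets the cardinality of a down-closed set of columns serve as a part of a
  partition.\<close>

lemma down_closed_eq_atLeastAtMost_card:
  fixes D :: "nat set"
  assumes "finite D" and "0 \<notin> D" and "\<And>i j. j \<in> D \<Longrightarrow> 1 \<le> i \<Longrightarrow> i \<le> j \<Longrightarrow> i \<in> D"
  shows "D = {1..card D}"
proof (cases "D = {}")
  case False
  have "D = {1..Max D}"
  proof (intro set_eqI iffI)
    fix i assume "i \<in> D"
    then show "i \<in> {1..Max D}"
      using assms(1,2) by (cases "i = 0") auto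
  next
    fix i assume "i \<in> {1..Max D}"
    then show "i \<in> D"
      using assms(3)[OF Max_in[OF assms(1) False], of i] by simp
  qed
  then show ?thesis
    by (metis card_atLeastAtMost diff_Suc_1)
qed simp

text \<open>The outer partition is the down-closure of the set inside the quadrant, and the inner one
  is what remains of it after removing the set.\<close>

lemma order_convex_is_skew_diagram:
  assumes "finite S" and conv: "order_convex S" and pos: "\<And>i j. (i, j) \<in> S \<Longrightarrow> 1 \<le> i \<and> 1 \<le> j"
  shows "is_skew_diagram S"
proof -
  define L where "L i = {j. 1 \<le> j \<and> (\<exists>a b. (a, b) \<in> S \<and> int i \<le> a \<and> int j \<le> b)}" for i :: nat
  define M where "M i = {j \<in> L i. (int i, int j) \<notin> S}" for i :: nat
  define lam mu where "lam i = card (L i)" and "mu i = card (M i)" for i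
  have finL: "finite (L i)" for i
  proof (rule finite_subset)
    show "L i \<subseteq> (\<Union>(a, b)\<in>S. {..nat b})"
      unfolding L_def by force
  qed (use assms(1) in auto)
  have finM: "finite (M i)" for i
    using finL by (auto simp: M_def)
  have L: "L i = {1..lam i}" for i
    unfolding lam_def by (rule down_closed_eq_atLeastAtMost_card[OF finL]) (force simp: L_def)+
  have Manti: "j \<in> M i" if j': "j' \<in> M i'" and "1 \<le> i" "i \<le> i'" "1 \<le> j" "j \<le> j'" for i j i' j'
  proof -
    obtain a b where ab: "(a, b) \<in> S" "int i' \<le> a" "int j' \<le> b" and n: "(int i', int j') \<notin> S"
      using j' unfolding M_def L_def by blast
    \<comment> \<open>Otherwise \<open>(i', j')\<close> would lie between \<open>(i, j)\<close> and
      \<open>(a, b)\<close>, hence in \<open>S\<close> by convexity.\<close>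
    have "(int i, int j) \<notin> S"
      using order_convexD[OF conv _ ab(1), of "int i" "int j" "int i'" "int j'"] n ab that by auto
    moreover have "j \<in> L i"
      unfolding L_def using ab that by force
    ultimately show ?thesis
      by (simp add: M_def)
  qed
  have M: "M i = {1..mu i}" if "1 \<le> i" for i
    unfolding mu_def
  proof (rule down_closed_eq_atLeastAtMost_card[OF finM])
    show "0 \<notin> M i" by (simp add: M_def L_def)
  qed (use that Manti in blast)
  have fin: "finite {i. 1 \<le> i \<and> lam i \<noteq> 0}"
  proof (rule finite_subset)
    show "{i. 1 \<le> i \<and> lam i \<noteq> 0} \<subseteq> (\<Union>(a, b)\<in>S. {..nat a})"
    proof
      fix i assume "i \<in> {i. 1 \<le> i \<and> lam i \<noteq> 0}"
      then have "1 \<in> L i" by (auto simp: L)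
      then show "i \<in> (\<Union>(a, b)\<in>S. {..nat a})" by (force simp: L_def)
    qed
  qed (use assms(1) in auto)
  have le: "mu i \<le> lam i" for i
    unfolding mu_def lam_def by (rule card_mono[OF finL]) (auto simp: M_def)
  have "is_partition lam"
    unfolding is_partition_def
  proof (intro conjI allI impI fin)
    fix i j :: nat assume "1 \<le> i" "i \<le> j"
    then show "lam j \<le> lam i"
      unfolding lam_def by (intro card_mono[OF finL]) (force simp: L_def)
  qed
  moreover have "is_partition mu"
    unfolding is_partition_def
  proof (intro conjI allI impI)
    fix i j :: nat assume "1 \<le> i" "i \<le> j"
    then show "mu j \<le> mu i"
      unfolding mu_def
    proof (intro card_mono[OF finM] subsetI)
      fix x assume x: "x \<in> M j"
      then have "1 \<le> x" by (simp add: M_def L_def)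
      with x show "x \<in> M i"
        using \<open>1 \<le> i\<close> \<open>i \<le> j\<close> by (blast intro: Manti)
    qed
  next
    show "finite {i. 1 \<le> i \<and> mu i \<noteq> 0}"
    proof (rule finite_subset[OF _ fin])
      show "{i. 1 \<le> i \<and> mu i \<noteq> 0} \<subseteq> {i. 1 \<le> i \<and> lam i \<noteq> 0}"
      proof
        fix i assume "i \<in> {i. 1 \<le> i \<and> mu i \<noteq> 0}"
        then show "i \<in> {i. 1 \<le> i \<and> lam i \<noteq> 0}" using le[of i] by simp
      qed
    qed
  qed
  moreover have "S = skew_cells lam mu"
  proof (intro set_eqI iffI)
    fix c assume c: "c \<in> S"
    define i j where "i = nat (fst c)" and "j = nat (snd c)"
    then have ij: "c = (int i, int j)" "1 \<le> i" "1 \<le> j"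
      using pos[of "fst c" "snd c"] c by (auto simp: prod_eq_iff)
    have "j \<in> L i" "j \<notin> M i" using c ij unfolding L_def M_def by auto
    then show "c \<in> skew_cells lam mu"
      using ij L M by (auto simp: skew_cells_def)
  next
    fix c assume "c \<in> skew_cells lam mu"
    then obtain i j where ij: "c = (int i, int j)" "1 \<le> i" "mu i < j" "j \<le> lam i"
      by (auto simp: skew_cells_def)
    then have "j \<in> L i" "j \<notin> M i" using L M by auto
    then show "c \<in> S" using ij by (auto simp: M_def)
  qed
  ultimately show ?thesis
    using le unfolding is_skew_diagram_def part_contained_def by blast
qed

section \<open>Translation classes and invariance under translation\<close>

lemma mem_translate: "c \<in> (+) v ` S \<longleftrightarrow> c - v \<in> S" for c v :: cell
  by (force simp: image_iff)

lemma translate_neg: "(+) (- v) ` (+) v ` S = S" for v :: cell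
  by (simp add: image_image)

lemma equiv_translation_rel: "equiv UNIV translation_rel"
proof (rule equivI)
  show "refl translation_rel"
  proof (rule refl_onI)
    fix S :: "cell set"
    have "S = (+) 0 ` S" by simp
    then show "(S, S) \<in> translation_rel"
      unfolding translation_rel_def by blast
  qed
  show "sym translation_rel"
  proof (rule symI)
    fix S T :: "cell set" assume "(S, T) \<in> translation_rel"
    then obtain v where "T = (+) v ` S" by (auto simp: translation_rel_def)
    then have "S = (+) (- v) ` T" by (simp only: translate_neg)
    then show "(T, S) \<in> translation_rel"
      unfolding translation_rel_def by blast
  qed
  show "trans translation_rel"
  proof (rule transI)
    fix S T R :: "cell set" assume "(S, T) \<in> translation_rel" "(T, R) \<in> translation_rel"
    then obtain v w where "T = (+) v ` S" "R = (+) w ` T" unfolding translation_rel_def by blast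
    then have "R = (+) (w + v) ` S" by (simp add: image_image add.assoc)
    then show "(S, R) \<in> translation_rel"
      unfolding translation_rel_def by blast
  qed
qed simp

lemma order_convex_translate:
  assumes "order_convex S"
  shows "order_convex ((+) v ` S)"
  unfolding order_convex_def
proof (intro allI impI)
  fix i j x y i' j'
  assume "(i, j) \<in> (+) v ` S" "(i', j') \<in> (+) v ` S" "i \<le> x" "x \<le> i'" "j \<le> y" "y \<le> j'"
  then show "(x, y) \<in> (+) v ` S"
    using order_convexD[OF assms, of "i - fst v" "j - snd v" "i' - fst v" "j' - snd v"
        "x - fst v" "y - snd v"]
    by (cases v) (simp add: mem_translate)
qed

lemma perimeter_translate: "perimeter ((+) v ` S) = perimeter S"
proof -
  have "fst ` (+) v ` S = (+) (fst v) ` fst ` S" "snd ` (+) v ` S = (+) (snd v) ` snd ` S"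
    by (simp_all add: image_image)
  then show ?thesis
    by (simp add: perimeter_def card_image)
qed

lemma skew_rank_translate: "skew_rank ((+) v ` S) = skew_rank S"
proof -
  obtain a b where v: "v = (a, b)" by force
  have out: "outside_top_corners ((+) v ` S) = (+) v ` outside_top_corners S"
    by (rule set_eqI) (simp add: mem_translate outside_top_corners_def v case_prod_beta, simp add: algebra_simps)
  have ins: "inside_top_corners ((+) v ` S) = (+) v ` inside_top_corners S"
    by (rule set_eqI) (simp add: mem_translate inside_top_corners_def v case_prod_beta, simp add: algebra_simps)
  have diag: "diagonal_from ((+) v ` S) (v + c) = (+) v ` diagonal_from S c" for c
  proof -
    have "(fst (v + c) + int t, snd (v + c) + int t) = v + (fst c + int t, snd c + int t)" for t
      by (simp add: v)
    then show ?thesis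
      unfolding diagonal_from_def by (auto simp: mem_translate)
  qed
  show ?thesis
    unfolding skew_rank_def out ins by (simp add: sum.reindex diag card_image)
qed

lemma edge_connected_translate:
  assumes "edge_connected S"
  shows "edge_connected ((+) v ` S)"
proof -
  let ?E = "\<lambda>S. {(x, y). x \<in> S \<and> y \<in> S \<and> edge_adjacent x y}"
  have "(v + c, v + d) \<in> (?E ((+) v ` S))\<^sup>*" if "(c, d) \<in> (?E S)\<^sup>*" for c d
    using that
  proof induction
    case (step y z)
    then have "(v + y, v + z) \<in> ?E ((+) v ` S)"
      by (auto simp: edge_adjacent_def)
    with step.IH show ?case by (rule rtrancl_into_rtrancl)
  qed simp
  then show ?thesis
    using assms unfolding edge_connected_def by blast
qed

section \<open>Two-coloured Motzkin words\<close>

text \<open>A letter records a simultaneous step of the upper and of the lower boundary path, \<^const>\<open>True\<close>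
  standing for a step upwards, and \<^term>\<open>h\<close> is the distance of the two paths.\<close>

fun motzkin_from :: "nat \<Rightarrow> (bool \<times> bool) list \<Rightarrow> bool" where
  "motzkin_from h [] \<longleftrightarrow> h = 0"
| "motzkin_from h ((True, False) # w) \<longleftrightarrow> motzkin_from (Suc h) w"
| "motzkin_from h ((False, True) # w) \<longleftrightarrow> (\<exists>h'. h = Suc h' \<and> motzkin_from h' w)"
| "motzkin_from h ((True, True) # w) \<longleftrightarrow> motzkin_from h w"
| "motzkin_from h ((False, False) # w) \<longleftrightarrow> motzkin_from h w"

definition ups :: "(bool \<times> bool) list \<Rightarrow> nat" where
  "ups w = length (filter (\<lambda>(a, b). a \<and> \<not> b) w)"

definition motzkin_words :: "nat \<Rightarrow> nat \<Rightarrow> nat \<Rightarrow> (bool \<times> bool) list set" where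
  "motzkin_words m h k = {w. length w = m \<and> motzkin_from h w \<and> ups w = k}"

text \<open>The ballot number: it counts the nonnegative paths with unit steps from height
  \<open>h\<close> to \<open>0\<close> with \<open>k\<close> up steps, which is what remains of a
  Motzkin word when its level letters are deleted.\<close>

definition ballot :: "nat \<Rightarrow> nat \<Rightarrow> real" where
  "ballot k h = real (Suc h) * fact (2 * k + h) / (fact k * fact (Suc (k + h)))"

text \<open>A nonempty path starts with an up step, leaving \<open>k - 1\<close> of them from height
  \<open>h + 1\<close>, or with a down step, which needs a positive height.\<close>

lemma ballot_rec:
  assumes "k \<noteq> 0 \<or> h \<noteq> 0"
  shows "ballot k h = (case k of 0 \<Rightarrow> 0 | Suc k' \<Rightarrow> ballot k' (Suc h)) +
                      (case h of 0 \<Rightarrow> 0 | Suc h' \<Rightarrow> ballot k h')"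
proof (cases k)
  case 0
  then obtain h' where "h = Suc h'" using assms by (cases h) auto
  have "ballot 0 n = 1" for n
  proof -
    have "real (Suc n) * fact n = fact (Suc n)" by simp
    then show ?thesis by (simp add: ballot_def del: fact_Suc)
  qed
  then show ?thesis
    using 0 \<open>h = Suc h'\<close> by simp
next
  case (Suc k')
  show ?thesis
  proof (cases h)
    case 0
    then show ?thesis using Suc by (simp add: ballot_def divide_simps) (simp add: algebra_simps)?
  next
    case h: (Suc h')
    define F where "F = (fact (2 * k' + h' + 2) :: real)"
    define G where "G = (fact (k' + h' + 2) :: real)"
    have 1: "(fact (2 * k + h) :: real) = real (2 * k' + h' + 3) * F"
      using Suc h by (simp add: F_def numeral_eq_Suc fact_reduce)
    have 2: "(fact (2 * k' + Suc h) :: real) = F" "(fact (2 * k + h') :: real) = F"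
      using Suc h by (simp_all add: F_def numeral_eq_Suc)
    have 3: "(fact (Suc (k + h)) :: real) = real (k' + h' + 3) * G"
      "(fact (Suc (k' + Suc h)) :: real) = real (k' + h' + 3) * G"
      "(fact (Suc (k + h')) :: real) = G"
      using Suc h by (simp_all add: G_def numeral_eq_Suc fact_reduce)
    have 4: "(fact k :: real) = real (k' + 1) * fact k'"
      using Suc by simp
    have "F > 0" "G > 0" by (simp_all add: F_def G_def)
    then have "ballot k h = ballot k' (Suc h) + ballot k h'"
      unfolding ballot_def 1 2 3 4 using h
      by (simp add: divide_simps del: fact_Suc) (simp add: algebra_simps)
    then show ?thesis
      using Suc h by simp
  qed
qed

lemma ballot_0_0: "ballot 0 0 = 1"
  by (simp add: ballot_def)

lemma ballot_catalan: "ballot k 0 = catalan k"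
proof -
  have "2 * k - k = k" by simp
  then have "real ((2 * k) choose k) = fact (2 * k) / (fact k * fact k)"
    using binomial_fact[of k "2 * k", where 'a = real] by simp
  then show ?thesis
    by (simp add: ballot_def catalan_def algebra_simps)
qed

lemma motzkin_words_Suc:
  "motzkin_words (Suc m) h k =
     (#) (True, True) ` motzkin_words m h k \<union> (#) (False, False) ` motzkin_words m h k \<union>
     (#) (True, False) ` (case k of 0 \<Rightarrow> {} | Suc k' \<Rightarrow> motzkin_words m (Suc h) k') \<union>
     (#) (False, True) ` (case h of 0 \<Rightarrow> {} | Suc h' \<Rightarrow> motzkin_words m h' k)" (is "?L = ?R")
proof (rule set_eqI)
  fix w
  show "w \<in> ?L \<longleftrightarrow> w \<in> ?R"
  proof (cases w)
    case Nil
    then show ?thesis by (auto simp: motzkin_words_def)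
  next
    case (Cons x u)
    obtain a b where "x = (a, b)" by force
    then show ?thesis
      using Cons
      by (cases a; cases b; cases k; cases h) (auto simp: motzkin_words_def ups_def image_iff)
  qed
qed

lemma finite_motzkin_words: "finite (motzkin_words m h k)"
  by (rule finite_subset[OF _ finite_lists_length_eq[of UNIV m]]) (auto simp: motzkin_words_def)

lemma card_motzkin_words_Suc:
  "card (motzkin_words (Suc m) h k) = 2 * card (motzkin_words m h k) +
     (case k of 0 \<Rightarrow> 0 | Suc k' \<Rightarrow> card (motzkin_words m (Suc h) k')) +
     (case h of 0 \<Rightarrow> 0 | Suc h' \<Rightarrow> card (motzkin_words m h' k))"
proof -
  have "card ((#) (True, True) ` A \<union> (#) (False, False) ` A \<union> (#) (True, False) ` B \<union> (#) (False, True) ` C)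
      = 2 * card A + card B + card C" if "finite A" "finite B" "finite C"
    for A B C :: "(bool \<times> bool) list set"
  proof -
    have "card (X \<union> Y) = card X + card Y" if "finite X" "finite Y" "X \<inter> Y = {}"
      for X Y :: "(bool \<times> bool) list set"
      using that by (rule card_Un_disjoint)
    moreover have "card ((#) x ` X) = card X" for x and X :: "(bool \<times> bool) list set"
      by (simp add: card_image)
    ultimately show ?thesis
      using that by (subst card_Un_disjoint, simp, simp, blast)+ simp
  qed
  then show ?thesis
    unfolding motzkin_words_Suc by (simp add: finite_motzkin_words split: nat.split)
qed

text \<open>Multiplied through by a power of two, so that the exponent is not truncated when
  \<^term>\<open>m < 2 * k + h\<close>.\<close>

lemma card_motzkin_words:
  "real (card (motzkin_words m h k)) * 2 ^ (2 * k + h) = 2 ^ m * real (m choose (2 * k + h)) * ballot k h"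
proof (induction m arbitrary: h k)
  case 0
  have "motzkin_words 0 h k = (if h = 0 \<and> k = 0 then {[]} else {})"
    by (auto simp: motzkin_words_def ups_def)
  then show ?case by (simp add: ballot_0_0)
next
  case (Suc m)
  show ?case
  proof (cases "k = 0 \<and> h = 0")
    case True
    then show ?thesis
      using Suc[of 0 0] by (simp add: card_motzkin_words_Suc ballot_0_0)
  next
    case False
    \<comment> \<open>An up step replaces \<open>(k, h)\<close> by \<open>(k - 1, h + 1)\<close>, a
      down step by \<open>(k, h - 1)\<close>; either way \<open>N\<close> non-level letters
      remain.\<close>
    define N where "N = 2 * k + h - 1"
    have N: "2 * k + h = Suc N" using False by (auto simp: N_def)
    have 1: "2 ^ N * real (case k of 0 \<Rightarrow> 0 | Suc k' \<Rightarrow> card (motzkin_words m (Suc h) k')) =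
        2 ^ m * real (m choose N) * (case k of 0 \<Rightarrow> 0 | Suc k' \<Rightarrow> ballot k' (Suc h))"
    proof (cases k)
      case (Suc k')
      then have "N = 2 * k' + Suc h" using N by simp
      then show ?thesis using Suc Suc.IH[of "Suc h" k'] by (simp add: mult.commute)
    qed simp
    have 2: "2 ^ N * real (case h of 0 \<Rightarrow> 0 | Suc h' \<Rightarrow> card (motzkin_words m h' k)) =
        2 ^ m * real (m choose N) * (case h of 0 \<Rightarrow> 0 | Suc h' \<Rightarrow> ballot k h')"
    proof (cases h)
      case (Suc h')
      then have "N = 2 * k + h'" using N by simp
      then show ?thesis using Suc Suc.IH[of h' k] by (simp add: mult.commute)
    qed simp
    have "real (card (motzkin_words (Suc m) h k)) * 2 ^ Suc N =
        2 * (real (card (motzkin_words m h k)) * 2 ^ Suc N) +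
        2 * (2 ^ N * real (case k of 0 \<Rightarrow> 0 | Suc k' \<Rightarrow> card (motzkin_words m (Suc h) k')) +
             2 ^ N * real (case h of 0 \<Rightarrow> 0 | Suc h' \<Rightarrow> card (motzkin_words m h' k)))"
      by (simp add: card_motzkin_words_Suc algebra_simps)
    also have "\<dots> = 2 * (2 ^ m * real (m choose Suc N) * ballot k h) +
        2 * (2 ^ m * real (m choose N) * ballot k h)"
      unfolding 1 2 using Suc.IH[of h k] ballot_rec[of k h] False
      by (simp only: N distrib_left[symmetric]) simp
    \<comment> \<open>Pascal's rule: the first letter is level or not.\<close>
    also have "\<dots> = 2 ^ Suc m * real (Suc m choose Suc N) * ballot k h"
      by (simp add: algebra_simps)
    finally show ?thesis unfolding N .
  qed
qed

text \<open>The exponent is negative when \<open>m < 2 * k\<close>, but then the binomial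
  coefficient vanishes.\<close>

lemma card_motzkin_words_0:
  "real (card (motzkin_words m 0 k)) = 2 powi (int m - 2 * int k) * real (m choose (2 * k)) * catalan k"
proof -
  have *: "(2::real) powi (int m - 2 * int k) = 2 ^ m / 2 ^ (2 * k)"
    using power_int_diff[of "2 :: real" "int m" "int (2 * k)"]
    by (simp only: power_int_of_nat) simp
  then show ?thesis
    using card_motzkin_words[of m 0 k] unfolding * by (simp add: ballot_catalan field_simps)
qed

section \<open>Polyominoes between two lattice paths\<close>

definition lattice_path :: "nat \<Rightarrow> (nat \<Rightarrow> int) \<Rightarrow> bool" where
  "lattice_path m f \<longleftrightarrow> (\<forall>c<m. f (Suc c) = f c \<or> f (Suc c) = f c - 1)"

text \<open>Each step either lowers the row \<open>f c\<close> by one and keeps the column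
  \<open>f c + int c\<close>, or keeps the row and raises the column by one.\<close>

lemma lattice_path_mono:
  assumes "lattice_path m f" "c \<le> d" "d \<le> m"
  shows "f d \<le> f c \<and> f c + int c \<le> f d + int d"
  using assms(2,3)
proof (induction d rule: dec_induct)
  case (step d)
  then have "f (Suc d) = f d \<or> f (Suc d) = f d - 1"
    using assms(1) unfolding lattice_path_def by simp
  then show ?case
    using step by auto
qed simp

text \<open>The diagonal of content \<^term>\<open>c\<close> occupies the rows from \<^term>\<open>p c\<close> to \<^term>\<open>q c\<close>. A boundary path
  going from the bottom left to the top right lowers the row index by one at each step upwards
  and keeps it at each step to the right.\<close>

definition region :: "nat \<Rightarrow> (nat \<Rightarrow> int) \<Rightarrow> (nat \<Rightarrow> int) \<Rightarrow> cell set" where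
  "region m p q = {(i, i + int c) | i c. c \<le> m \<and> p c \<le> i \<and> i \<le> q c}"

lemma mem_region: "(i, j) \<in> region m p q \<longleftrightarrow> (\<exists>c\<le>m. j = i + int c \<and> p c \<le> i \<and> i \<le> q c)"
  by (auto simp: region_def)

lemma mem_region_diagonal: "(i, i + int c) \<in> region m p q \<longleftrightarrow> c \<le> m \<and> p c \<le> i \<and> i \<le> q c"
  by (auto simp: region_def)

text \<open>The paths run through the top and bottom cells of the diagonals, so they may touch:
  \<open>p c = q c\<close> means a single cell. Both outermost diagonals are single cells, and
  placing the first at the origin fixes the translate.\<close>

locale staircase =
  fixes m :: nat and p q :: "nat \<Rightarrow> int"
  assumes path_p: "lattice_path m p" and path_q: "lattice_path m q"
    and p_0: "p 0 = 0" and q_0: "q 0 = 0" and end_eq: "q m = p m"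
    and p_le_q: "c \<le> m \<Longrightarrow> p c \<le> q c"
begin

abbreviation "R \<equiv> region m p q"

lemma p_step: "c < m \<Longrightarrow> p (Suc c) = p c \<or> p (Suc c) = p c - 1"
  and q_step: "c < m \<Longrightarrow> q (Suc c) = q c \<or> q (Suc c) = q c - 1"
  using path_p path_q by (auto simp: lattice_path_def)

lemma region_bounds:
  assumes "(i, j) \<in> R"
  shows "p m \<le> i" "i \<le> 0" "0 \<le> j" "j \<le> p m + int m"
proof -
  obtain c where c: "c \<le> m" "j = i + int c" "p c \<le> i" "i \<le> q c"
    using assms by (auto simp: mem_region)
  then show "p m \<le> i" "i \<le> 0" "0 \<le> j" "j \<le> p m + int m"
    using lattice_path_mono[OF path_p, of 0 c] lattice_path_mono[OF path_p, of c m]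
      lattice_path_mono[OF path_q, of 0 c] lattice_path_mono[OF path_q, of c m]
    by (auto simp: p_0 q_0 end_eq)
qed

lemma finite_region: "finite R"
  by (rule finite_subset[of _ "{p m..0} \<times> {0..p m + int m}"]) (auto dest: region_bounds)

lemma order_convex_region: "order_convex R"
  unfolding order_convex_def
proof (intro allI impI)
  fix i j x y i' j'
  assume a: "(i, j) \<in> R" and b: "(i', j') \<in> R" and xy: "i \<le> x" "x \<le> i'" "j \<le> y" "y \<le> j'"
  obtain c where c: "c \<le> m" "j = i + int c" "p c \<le> i"
    using a by (auto simp: mem_region)
  obtain d where d: "d \<le> m" "j' = i' + int d" "i' \<le> q d"
    using b by (auto simp: mem_region)
  define e where "e = nat (y - x)"
  have e: "y = x + int e" "e \<le> m"
    using region_bounds[OF a] region_bounds[OF b] xy by (auto simp: e_def)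
  \<comment> \<open>For \<open>c \<le> e\<close> compare rows,
    \<open>p e \<le> p c \<le> i \<le> x\<close>; otherwise columns,
    \<open>p e + int e \<le> p c + int c \<le> j \<le> y\<close>.\<close>
  have "p e \<le> x"
    using lattice_path_mono[OF path_p, of c e] lattice_path_mono[OF path_p, of e c] c e xy
    by (cases "c \<le> e") auto
  moreover have "x \<le> q e"
    using lattice_path_mono[OF path_q, of d e] lattice_path_mono[OF path_q, of e d] d e xy
    by (cases "d \<le> e") auto
  ultimately show "(x, y) \<in> R"
    using e by (auto simp: mem_region)
qed

lemma edge_connected_region: "edge_connected R"
proof -
  let ?E = "{(x, y). x \<in> R \<and> y \<in> R \<and> edge_adjacent x y}"
  have "(0, 0) \<in> R"
    by (auto simp: mem_region p_0 q_0 intro!: exI[of _ 0])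
  have "((i, i + int c), (0, 0)) \<in> ?E\<^sup>*" if "c \<le> m" "p c \<le> i" "i \<le> q c" for i c
    using that
  proof (induction c arbitrary: i)
    case 0
    then show ?case by (simp add: p_0 q_0)
  next
    case (Suc c)
    \<comment> \<open>The left neighbour if it belongs to the region, otherwise the cell
      below.\<close>
    define i' where "i' = (if p c \<le> i then i else i + 1)"
    have i': "p c \<le> i'" "i' \<le> q c"
      using p_step[of c] q_step[of c] p_le_q[of c] Suc.prems by (auto simp: i'_def)
    have "((i, i + int (Suc c)), (i', i' + int c)) \<in> ?E"
      using i' Suc.prems by (auto simp: mem_region edge_adjacent_def) (auto simp: i'_def)
    moreover have "((i', i' + int c), (0, 0)) \<in> ?E\<^sup>*"
      using Suc i' by simp
    ultimately show ?case
      by (rule converse_rtrancl_into_rtrancl)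
  qed
  then have to: "(x, (0, 0)) \<in> ?E\<^sup>*" if "x \<in> R" for x
    using that by (auto simp: region_def)
  have "sym (?E\<^sup>*)"
    by (rule sym_rtrancl) (auto simp: sym_def edge_adjacent_def)
  then have "(x, y) \<in> ?E\<^sup>*" if "x \<in> R" "y \<in> R" for x y
    using to[OF that(1)] to[OF that(2)] by (meson rtrancl_trans symD)
  then show ?thesis
    using \<open>(0, 0) \<in> R\<close> unfolding edge_connected_def by blast
qed

text \<open>There are \<open>1 - p m\<close> rows and \<open>p m + int m + 1\<close> columns, so the
  shape of the paths cancels from the sum.\<close>

lemma perimeter_region: "perimeter R = 2 * (m + 2)"
proof -
  have "fst ` R = {p m..0}"
  proof (intro equalityI subsetI)
    fix i assume i: "i \<in> {p m..0}"
    \<comment> \<open>Discrete intermediate values: \<open>- q\<close> rises by at most one per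
      step, so \<open>q\<close> visits every row.\<close>
    have "\<exists>c\<le>m. - q c = - i"
      using i q_step end_eq q_0 by (intro nat0_intermed_int_val) force+
    then obtain c where "c \<le> m" "q c = i" by auto
    then have "(i, i + int c) \<in> R" using p_le_q by (auto simp: mem_region)
    then show "i \<in> fst ` R" by force
  qed (auto dest: region_bounds)
  moreover have "snd ` R = {0..p m + int m}"
  proof (intro equalityI subsetI)
    fix j assume j: "j \<in> {0..p m + int m}"
    have "\<exists>c\<le>m. q c + int c = j"
      using j q_step end_eq q_0 by (intro nat0_intermed_int_val) force+
    then obtain c where "c \<le> m" "q c + int c = j" by auto
    then have "(q c, j) \<in> R" using p_le_q by (auto simp: mem_region)
    then show "j \<in> snd ` R" by force
  qed (auto dest: region_bounds)
  moreover have "p m \<le> 0" "0 \<le> p m + int m"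
    using lattice_path_mono[OF path_p, of 0 m] by (auto simp: p_0)
  ultimately show ?thesis
    by (simp add: perimeter_def)
qed

lemma diagonal_from_region:
  assumes "c \<le> m"
  shows "card (diagonal_from R (p c, p c + int c)) = nat (q c - p c + 1)"
proof -
  have "diagonal_from R (p c, p c + int c) = (\<lambda>i. (i, i + int c)) ` {p c..q c}"
  proof (intro equalityI subsetI)
    fix x assume "x \<in> diagonal_from R (p c, p c + int c)"
    then obtain t where t: "x = (p c + int t, p c + int c + int t)" "x \<in> R"
      by (auto simp: diagonal_from_def)
    then have "p c + int t \<le> q c"
      by (auto simp: mem_region)
    then show "x \<in> (\<lambda>i. (i, i + int c)) ` {p c..q c}"
      using t by (auto intro!: image_eqI[of _ _ "p c + int t"])
  next
    fix x assume "x \<in> (\<lambda>i. (i, i + int c)) ` {p c..q c}"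
    then obtain i where i: "x = (i, i + int c)" "p c \<le> i" "i \<le> q c" by auto
    then show "x \<in> diagonal_from R (p c, p c + int c)"
      using assms by (auto simp: diagonal_from_def mem_region intro!: exI[of _ "nat (i - p c)"])
  qed
  moreover have "inj_on (\<lambda>i. (i, i + int c)) {p c..q c}"
    by (auto simp: inj_on_def)
  ultimately show ?thesis
    by (simp add: card_image)
qed

text \<open>The steps of the upper boundary path of the polyomino, with its first and last step added:
  \<^term>\<open>1\<close> for a step upwards and \<^term>\<open>0\<close> for a step to the right.\<close>

definition u :: "nat \<Rightarrow> int" where
  "u c = (if c = 0 then 1 else if c \<le> m then p (c - 1) - p c else 0)"

lemma u_cases: "u c = 0 \<or> u c = 1"
proof (cases c)
  case (Suc d)
  then show ?thesis using p_step[of d] by (auto simp: u_def)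
qed (simp add: u_def)

text \<open>The cell above has content \<open>c + 1\<close>, so it can only be the top cell of the
  next diagonal. For \<open>c = m\<close> there is no such diagonal, which agrees with
  \<open>u (Suc m) = 0\<close>.\<close>

lemma up_neighbour_mem:
  assumes "c \<le> m"
  shows "(p c - 1, p c + int c) \<in> R \<longleftrightarrow> u (Suc c) = 1"
proof -
  have "(p c - 1, p c + int c) \<in> R \<longleftrightarrow> Suc c \<le> m \<and> p (Suc c) \<le> p c - 1 \<and> p c - 1 \<le> q (Suc c)"
    using mem_region_diagonal[of "p c - 1" "Suc c"] by simp
  also have "\<dots> \<longleftrightarrow> Suc c \<le> m \<and> p (Suc c) = p c - 1"
    using p_step[of c] q_step[of c] p_le_q[of c] by auto
  finally show ?thesis
    by (auto simp: u_def)
qed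

text \<open>The left cell has content \<open>c - 1\<close> and is present iff the path steps right
  to reach diagonal \<open>c\<close>. For \<open>c = 0\<close> it is absent, which agrees with
  \<open>u 0 = 1\<close>.\<close>

lemma left_neighbour_mem:
  assumes "c \<le> m"
  shows "(p c, p c + int c - 1) \<in> R \<longleftrightarrow> u c = 0"
proof (cases c)
  case (Suc d)
  have d: "d < m" using Suc assms by simp
  have "(p c, p c + int c - 1) \<in> R \<longleftrightarrow> p d \<le> p c \<and> p c \<le> q d"
    using mem_region_diagonal[of "p c" d] d by (simp add: Suc)
  also have "\<dots> \<longleftrightarrow> p d = p c"
  proof -
    have "p c = p d \<or> p c = p d - 1" "p d \<le> q d"
      using p_step[OF d] p_le_q[of d] d unfolding Suc by simp_all
    then show ?thesis by (elim disjE) simp_all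
  qed
  finally show ?thesis
    using d by (auto simp: u_def Suc)
qed (auto simp: mem_region u_def)

text \<open>Both kinds of corner lack their upper left diagonal neighbour, so every corner is the
  top cell of its diagonal.\<close>

lemma mem_region_top:
  assumes "(i, j) \<in> R" "(i - 1, j - 1) \<notin> R"
  obtains c where "c \<le> m" "i = p c" "j = p c + int c"
proof -
  obtain c where c: "c \<le> m" "j = i + int c" "p c \<le> i" "i \<le> q c"
    using assms(1) by (auto simp: mem_region)
  then have "\<not> p c \<le> i - 1"
    using assms(2) by (auto simp: mem_region)
  then show thesis using that[of c] c by simp
qed

lemma top_mem: "c \<le> m \<Longrightarrow> (p c, p c + int c) \<in> R" "(p c - 1, p c + int c - 1) \<notin> R"
  using p_le_q by (auto simp: mem_region)

lemma outside_top_corners_region: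
  "outside_top_corners R = (\<lambda>c. (p c, p c + int c)) ` {c. c \<le> m \<and> u c = 1 \<and> u (Suc c) = 0}"
proof (intro equalityI subsetI)
  fix x assume x: "x \<in> outside_top_corners R"
  obtain i j where ij: "x = (i, j)" "(i, j) \<in> R" "(i - 1, j) \<notin> R" "(i, j - 1) \<notin> R"
    using x by (auto simp: outside_top_corners_def)
  \<comment> \<open>If it were in the region, convexity between it and \<open>(i, j)\<close> would
    give \<open>(i - 1, j)\<close>.\<close>
  then have "(i - 1, j - 1) \<notin> R"
    using order_convexD[OF order_convex_region, of "i - 1" "j - 1" i j "i - 1" j] by auto
  then obtain c where "c \<le> m" "i = p c" "j = p c + int c"
    using ij mem_region_top by blast
  then show "x \<in> (\<lambda>c. (p c, p c + int c)) ` {c. c \<le> m \<and> u c = 1 \<and> u (Suc c) = 0}"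
    using ij up_neighbour_mem left_neighbour_mem u_cases by auto
next
  fix x assume "x \<in> (\<lambda>c. (p c, p c + int c)) ` {c. c \<le> m \<and> u c = 1 \<and> u (Suc c) = 0}"
  then show "x \<in> outside_top_corners R"
    using up_neighbour_mem left_neighbour_mem top_mem by (auto simp: outside_top_corners_def)
qed

lemma inside_top_corners_region:
  "inside_top_corners R = (\<lambda>c. (p c, p c + int c)) ` {c. c \<le> m \<and> u c = 0 \<and> u (Suc c) = 1}"
proof (intro equalityI subsetI)
  fix x assume x: "x \<in> inside_top_corners R"
  obtain i j where ij: "x = (i, j)" "(i, j) \<in> R" "(i - 1, j) \<in> R" "(i, j - 1) \<in> R"
    "(i - 1, j - 1) \<notin> R"
    using x by (auto simp: inside_top_corners_def)
  then obtain c where "c \<le> m" "i = p c" "j = p c + int c"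
    using mem_region_top by blast
  then show "x \<in> (\<lambda>c. (p c, p c + int c)) ` {c. c \<le> m \<and> u c = 0 \<and> u (Suc c) = 1}"
    using ij up_neighbour_mem left_neighbour_mem by auto
next
  fix x assume "x \<in> (\<lambda>c. (p c, p c + int c)) ` {c. c \<le> m \<and> u c = 0 \<and> u (Suc c) = 1}"
  then show "x \<in> inside_top_corners R"
    using up_neighbour_mem left_neighbour_mem top_mem by (auto simp: inside_top_corners_def)
qed

lemma skew_rank_region:
  "skew_rank R = 1 + int (card {c. c < m \<and> p (Suc c) = p c - 1 \<and> q (Suc c) = q c})"
proof -
  define D where "D c = q c - p c + 1" for c
  have inj: "inj_on (\<lambda>c. (p c, p c + int c)) A" for A
    by (auto simp: inj_on_def)
  have corners: "(\<Sum>x\<in>(\<lambda>c. (p c, p c + int c)) ` {c. c \<le> m \<and> P c}. int (card (diagonal_from R x))) =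
      (\<Sum>c\<le>m. if P c then D c else 0)" for P
  proof -
    have "(\<Sum>x\<in>(\<lambda>c. (p c, p c + int c)) ` {c. c \<le> m \<and> P c}. int (card (diagonal_from R x))) =
        (\<Sum>c | c \<le> m \<and> P c. D c)"
      unfolding sum.reindex[OF inj] o_def
      by (rule sum.cong) (use p_le_q in \<open>auto simp: diagonal_from_region D_def\<close>)
    also have "\<dots> = (\<Sum>c\<le>m. if P c then D c else 0)"
      by (rule sum.mono_neutral_cong_left) auto
    finally show ?thesis .
  qed
  \<comment> \<open>The factor \<open>u c - u (Suc c)\<close> is \<open>1\<close> at outside
    corners, \<open>-1\<close> at inside ones and \<open>0\<close> elsewhere.\<close>
  have "skew_rank R = (\<Sum>c\<le>m. (u c - u (Suc c)) * D c)"
    unfolding skew_rank_def outside_top_corners_region inside_top_corners_region corners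
      sum_subtractf[symmetric]
  proof (rule sum.cong)
    fix c
    show "(if u c = 1 \<and> u (Suc c) = 0 then D c else 0) - (if u c = 0 \<and> u (Suc c) = 1 then D c else 0) =
        (u c - u (Suc c)) * D c"
      using u_cases[of c] u_cases[of "Suc c"] by auto
  qed simp
  \<comment> \<open>summation by parts\<close>
  also have "(\<Sum>c\<le>k. (u c - u (Suc c)) * D c) =
      D 0 + (\<Sum>c<k. u (Suc c) * (D (Suc c) - D c)) - u (Suc k) * D k" for k
    by (induction k) (simp_all add: u_def algebra_simps)
  also have "D 0 + (\<Sum>c<m. u (Suc c) * (D (Suc c) - D c)) - u (Suc m) * D m =
      1 + (\<Sum>c<m. if p (Suc c) = p c - 1 \<and> q (Suc c) = q c then 1 else 0)"
  proof -
    \<comment> \<open>When the upper path goes up, the diagonal length grows by one if the lower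
      path goes right and is unchanged if it also goes up.\<close>
    have "u (Suc c) * (D (Suc c) - D c) = (if p (Suc c) = p c - 1 \<and> q (Suc c) = q c then 1 else 0)"
      if "c < m" for c
      using p_step[OF that] q_step[OF that] that by (auto simp: u_def D_def)
    then show ?thesis
      by (simp add: D_def p_0 q_0 u_def)
  qed
  also have "(\<Sum>c<m. if p (Suc c) = p c - 1 \<and> q (Suc c) = q c then 1 else 0 :: int) =
      int (card {c \<in> {..<m}. p (Suc c) = p c - 1 \<and> q (Suc c) = q c})"
    by (simp add: sum.inter_filter[symmetric])
  finally show ?thesis by simp
qed

end

section \<open>Boundary paths of a connected skew diagram\<close>

text \<open>Applied to the content, this finds an edge between two consecutive diagonals.\<close>

lemma rtrancl_crossing:
  assumes "(x, y) \<in> E\<^sup>*" "f x \<le> (k::int)" "k < f y"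
  shows "\<exists>s t. (s, t) \<in> E \<and> f s \<le> k \<and> k < f t"
  using assms
proof induction
  case (step y z)
  then show ?case by (cases "k < f y") force+
qed simp

text \<open>Convexity makes each diagonal of \<open>T\<close> an interval of rows, connectedness
  links consecutive diagonals by an edge, and together they force both interval ends to move by
  \<open>0\<close> or \<open>-1\<close>.\<close>

lemma connected_order_convex_is_region:
  assumes fin: "finite T" and conv: "order_convex T" and conn: "edge_connected T"
  obtains m p q v where "staircase m p q" "T = (+) v ` region m p q"
proof -
  define K where "K = (\<lambda>(i, j). j - i) ` T"
  have K: "finite K" "K \<noteq> {}"
    using fin conn by (auto simp: K_def edge_connected_def)
  define a m where "a = Min K" and "m = nat (Max K - a)"
  have a_le: "a \<le> j - i" and le_m: "j - i \<le> a + int m" if "(i, j) \<in> T" for i j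
  proof -
    have "j - i \<in> K" using that by (force simp: K_def)
    then show "a \<le> j - i" "j - i \<le> a + int m"
      using K Min_le[of K "j - i"] Max_ge[of K "j - i"] by (auto simp: a_def m_def)
  qed
  define D where "D c = {i. (i, i + a + int c) \<in> T}" for c
  have D_empty: "c \<le> m" if "i \<in> D c" for i c
    using le_m[of i "i + a + int c"] that by (auto simp: D_def)
  have end_mem: "a \<in> K" "a + int m \<in> K"
    using K Min_in[of K] Max_in[of K] Min_le[of K "Max K"] by (auto simp: a_def m_def)
  \<comment> \<open>Adjacent cells differ in content by one, so a path between the extreme contents
    has an edge from content \<open>a + int c\<close> to the next, going right or up.\<close>
  have crossing: "\<exists>i. i \<in> D c \<and> (i \<in> D (Suc c) \<or> i - 1 \<in> D (Suc c))" if "c < m" for c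
  proof -
    obtain x y where xy: "x \<in> T" "snd x - fst x = a" "y \<in> T" "snd y - fst y = a + int m"
      using end_mem by (auto simp: K_def)
    then have "(x, y) \<in> {(x, y). x \<in> T \<and> y \<in> T \<and> edge_adjacent x y}\<^sup>*"
      using conn by (auto simp: edge_connected_def)
    then have "\<exists>s t. (s, t) \<in> {(x, y). x \<in> T \<and> y \<in> T \<and> edge_adjacent x y} \<and>
        snd s - fst s \<le> a + int c \<and> a + int c < snd t - fst t"
      by (rule rtrancl_crossing) (use xy that in auto)
    then obtain i j i' j' where st: "(i, j) \<in> T" "(i', j') \<in> T" "\<bar>i - i'\<bar> + \<bar>j - j'\<bar> = 1"
      "j - i \<le> a + int c" "a + int c < j' - i'"
      by (auto simp: edge_adjacent_def)
    then have "j = i + a + int c" "(i' = i \<or> i' = i - 1) \<and> j' = i' + a + int (Suc c)"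
      by auto
    then show ?thesis
      using st unfolding D_def by blast
  qed
  have D_nonempty: "D c \<noteq> {}" if "c \<le> m" for c
  proof (cases "c < m")
    case True
    then show ?thesis using crossing[of c] by blast
  next
    case False
    obtain i j where "(i, j) \<in> T" "j - i = a + int m"
      using end_mem by (auto simp: K_def)
    then have "i \<in> D m" by (auto simp: D_def algebra_simps)
    then show ?thesis using False that by auto
  qed
  have D_finite: "finite (D c)" for c
    by (rule finite_subset[of _ "fst ` T"]) (use fin in \<open>force simp: D_def\<close>)+
  define P Q where "P c = Min (D c)" and "Q c = Max (D c)" for c
  have P_mem: "P c \<in> D c" and Q_mem: "Q c \<in> D c" if "c \<le> m" for c
    using D_finite D_nonempty[OF that] by (auto simp: P_def Q_def)
  have P_le: "P c \<le> i" and Q_ge: "i \<le> Q c" if "i \<in> D c" for i c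
    using D_finite that by (auto simp: P_def Q_def)
  have conv': "x \<in> D e" if "i \<in> D c" "i' \<in> D d" "i \<le> x" "x \<le> i'"
    "i + int c \<le> x + int e" "x + int e \<le> i' + int d" for x e i i' c d
    using that order_convexD[OF conv, of i "i + a + int c" i' "i' + a + int d" x "x + a + int e"]
    unfolding D_def by simp
  have D_iff: "i \<in> D c \<longleftrightarrow> c \<le> m \<and> P c \<le> i \<and> i \<le> Q c" for i c
    using D_empty P_le Q_ge conv'[OF P_mem[of c] Q_mem[of c], of i c] by auto
  have P_step: "P (Suc c) = P c \<or> P (Suc c) = P c - 1" if c: "c < m" for c
  proof -
    obtain i where i: "i \<in> D c" "i \<in> D (Suc c) \<or> i - 1 \<in> D (Suc c)"
      using crossing[OF c] by blast
    \<comment> \<open>If \<open>P c\<close> is not in \<open>D (Suc c)\<close>, convexity excludes a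
      linked cell in row \<open>P c\<close> or below, so the linked cell lies above that
      row.\<close>
    have "P (Suc c) \<le> P c"
    proof (cases "P c \<in> D (Suc c)")
      case False
      then have "\<not> i \<in> D (Suc c)" "\<not> (P c \<le> i - 1 \<and> i - 1 \<in> D (Suc c))"
        using conv'[OF P_mem[of c], of i "Suc c" "P c" "Suc c"]
          conv'[OF P_mem[of c], of "i - 1" "Suc c" "P c" "Suc c"] P_le[OF i(1)] c by auto
      then show ?thesis
        using i P_le[OF i(1)] P_le[of "i - 1" "Suc c"] by auto
    qed (rule P_le)
    moreover have "P c - 1 \<le> P (Suc c)"
    proof (rule ccontr)
      assume "\<not> ?thesis"
      \<comment> \<open>The cell below the top cell of diagonal \<open>Suc c\<close> would lie on
        diagonal \<open>c\<close>, above its top cell.\<close>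
      then have "P (Suc c) + 1 \<in> D c"
        using conv'[OF P_mem[of "Suc c"] P_mem[of c], of "P (Suc c) + 1" c] c by auto
      then show False
        using P_le[of "P (Suc c) + 1" c] \<open>\<not> P c - 1 \<le> P (Suc c)\<close> by simp
    qed
    ultimately show ?thesis by auto
  qed
  have Q_step: "Q (Suc c) = Q c \<or> Q (Suc c) = Q c - 1" if c: "c < m" for c
  proof -
    obtain i where i: "i \<in> D c" "i \<in> D (Suc c) \<or> i - 1 \<in> D (Suc c)"
      using crossing[OF c] by blast
    have "Q c - 1 \<le> Q (Suc c)"
    proof (cases "Q c - 1 \<in> D (Suc c)")
      case False
      then have "\<not> i - 1 \<in> D (Suc c)" "\<not> (i \<le> Q c - 1 \<and> i \<in> D (Suc c))"
        using conv'[OF _ Q_mem[of c], of i "Suc c" "Q c - 1" "Suc c"]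
          conv'[OF _ Q_mem[of c], of "i - 1" "Suc c" "Q c - 1" "Suc c"] Q_ge[OF i(1)] c by auto
      then show ?thesis
        using i Q_ge[OF i(1)] Q_ge[of i "Suc c"] by auto
    qed (rule Q_ge)
    moreover have "Q (Suc c) \<le> Q c"
    proof (rule ccontr)
      assume "\<not> ?thesis"
      \<comment> \<open>The cell left of the bottom cell of diagonal \<open>Suc c\<close> would lie
        on diagonal \<open>c\<close>, below its bottom cell.\<close>
      then have "Q (Suc c) \<in> D c"
        using conv'[OF Q_mem[of c] Q_mem[of "Suc c"], of "Q (Suc c)" c] c by auto
      then show False
        using Q_ge[of "Q (Suc c)" c] \<open>\<not> Q (Suc c) \<le> Q c\<close> by simp
    qed
    ultimately show ?thesis by auto
  qed
  have start: "P 0 = Q 0"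
  proof (rule ccontr)
    assume "P 0 \<noteq> Q 0"
    then have "P 0 + 1 \<le> Q 0" using P_le[OF Q_mem[of 0]] by auto
    \<comment> \<open>The cell below the top cell of the first diagonal would have content
      \<open>a - 1\<close>.\<close>
    then have "(P 0 + 1, P 0 + a) \<in> T"
      using P_mem[of 0] Q_mem[of 0]
        order_convexD[OF conv, of "P 0" "P 0 + a" "Q 0" "Q 0 + a" "P 0 + 1" "P 0 + a"]
      by (auto simp: D_def)
    then show False using a_le by force
  qed
  have last: "Q m = P m"
  proof (rule ccontr)
    assume "Q m \<noteq> P m"
    then have "P m + 1 \<le> Q m" using P_le[OF Q_mem[of m]] by auto
    \<comment> \<open>Likewise the right neighbour of the top cell would exceed the largest
      content.\<close>
    then have "P m \<in> D (Suc m)"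
      by (intro conv'[OF P_mem[of m] Q_mem[of m]]) auto
    then show False using D_empty by force
  qed
  define p q where "p c = P c - P 0" and "q c = Q c - P 0" for c
  have "staircase m p q"
    using P_step Q_step start last P_le[OF Q_mem]
    by unfold_locales (auto simp: p_def q_def lattice_path_def)
  moreover have "T = (+) (P 0, P 0 + a) ` region m p q"
  proof (intro set_eqI)
    fix x :: cell
    obtain i j where x: "x = (i, j)" by force
    have "(i, j) \<in> T \<longleftrightarrow> (\<exists>c. j = i + a + int c \<and> i \<in> D c)"
    proof
      assume "(i, j) \<in> T"
      then show "\<exists>c. j = i + a + int c \<and> i \<in> D c"
        using a_le[of i j] by (intro exI[of _ "nat (j - i - a)"]) (auto simp: D_def)
    qed (auto simp: D_def)
    then show "x \<in> T \<longleftrightarrow> x \<in> (+) (P 0, P 0 + a) ` region m p q"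
      unfolding x mem_translate by (auto simp: mem_region D_iff p_def q_def)
  qed
  ultimately show thesis by (rule that)
qed

section \<open>Encoding regions by Motzkin words\<close>

definition word_height :: "((bool \<times> bool) \<Rightarrow> bool) \<Rightarrow> (bool \<times> bool) list \<Rightarrow> nat \<Rightarrow> int" where
  "word_height g w c = - int (length (filter g (take c w)))"

definition word_region :: "(bool \<times> bool) list \<Rightarrow> cell set" where
  "word_region w = region (length w) (word_height fst w) (word_height snd w)"

lemma word_height_0 [simp]: "word_height g w 0 = 0"
  by (simp add: word_height_def)

lemma word_height_Suc:
  "c < length w \<Longrightarrow> word_height g w (Suc c) = word_height g w c - (if g (w ! c) then 1 else 0)"
  by (simp add: word_height_def take_Suc_conv_app_nth)

lemma word_height_Cons: "word_height g (x # w) (Suc c) = word_height g w c - (if g x then 1 else 0)"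
  by (simp add: word_height_def)

text \<open>The height after \<open>c\<close> letters is
  \<open>word_height snd w c + int h - word_height fst w c\<close>.\<close>

lemma motzkin_from_iff:
  "motzkin_from h w \<longleftrightarrow>
     (\<forall>c\<le>length w. word_height fst w c \<le> word_height snd w c + int h) \<and>
     word_height fst w (length w) = word_height snd w (length w) + int h"
proof -
  have split: "(\<forall>c\<le>Suc n. P c) \<longleftrightarrow> P 0 \<and> (\<forall>c\<le>n. P (Suc c))" for n and P :: "nat \<Rightarrow> bool"
    by (metis Suc_le_mono not0_implies_Suc zero_le)
  show ?thesis
  proof (induction h w rule: motzkin_from.induct)
    case (3 h w)
    show ?case
    proof (cases h)
      case 0
      have "\<not> word_height fst w 0 \<le> word_height snd w 0 - 1" by simp
      then show ?thesis
        using 0 by (auto simp: split word_height_Cons)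
    next
      case (Suc h')
      then show ?thesis
        using 3[of h'] by (simp add: split word_height_Cons algebra_simps)
    qed
  qed (simp_all add: split word_height_Cons algebra_simps)
qed

lemma staircase_word_iff:
  "staircase (length w) (word_height fst w) (word_height snd w) \<longleftrightarrow> motzkin_from 0 w"
  by (auto simp: staircase_def lattice_path_def word_height_Suc motzkin_from_iff)

lemma ups_eq_card:
  "ups w = card {c. c < length w \<and> word_height fst w (Suc c) = word_height fst w c - 1 \<and>
                    word_height snd w (Suc c) = word_height snd w c}"
proof -
  have "ups w = card {c. c < length w \<and> fst (w ! c) \<and> \<not> snd (w ! c)}"
    by (simp add: ups_def length_filter_conv_card case_prod_beta)
  also have "\<dots> = card {c. c < length w \<and> word_height fst w (Suc c) = word_height fst w c - 1 \<and>
                    word_height snd w (Suc c) = word_height snd w c}"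
    by (rule arg_cong[of _ _ card]) (auto simp: word_height_Suc split: if_splits)
  finally show ?thesis .
qed

lemma staircase_word:
  assumes "staircase m p q"
  obtains w where "length w = m" "motzkin_from 0 w" "region m p q = word_region w"
proof -
  interpret staircase m p q by fact
  define w where "w = map (\<lambda>c. (p (Suc c) = p c - 1, q (Suc c) = q c - 1)) [0..<m]"
  have len: "length w = m" by (simp add: w_def)
  have "word_height fst w c = p c \<and> word_height snd w c = q c" if "c \<le> m" for c
    using that
  proof (induction c)
    case (Suc c)
    then show ?case
      using p_step[of c] q_step[of c] by (auto simp: word_height_Suc len) (auto simp: w_def)
  qed (simp add: p_0 q_0)
  then have eq: "word_height fst w c = p c" "word_height snd w c = q c" if "c \<le> m" for c
    using that by auto
  have "region m p q = word_region w"
    unfolding word_region_def len region_def using eq by auto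
  moreover have "staircase (length w) (word_height fst w) (word_height snd w)"
    unfolding len staircase_def lattice_path_def
    using eq p_step q_step p_0 q_0 end_eq p_le_q by auto
  ultimately show thesis
    using that[OF len] unfolding staircase_word_iff by blast
qed

lemma word_region_translate_eq:
  assumes "motzkin_from 0 w" "motzkin_from 0 w'" and len: "length w' = length w"
    and eq: "word_region w' = (+) v ` word_region w"
  shows "w' = w"
proof -
  define m p q p' q' where "m = length w" and "p = word_height fst w" and "q = word_height snd w"
    and "p' = word_height fst w'" and "q' = word_height snd w'"
  interpret staircase m p q
    using assms(1) by (simp add: m_def p_def q_def staircase_word_iff)
  interpret w': staircase m p' q'
    using assms(2) by (simp add: m_def p'_def q'_def len[symmetric] staircase_word_iff)
  have R: "word_region w = R" "word_region w' = w'.R"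
    by (simp_all add: word_region_def m_def p_def q_def p'_def q'_def len)
  obtain a b where v: "v = (a, b)" by force
  have mem: "(i + a, j + b) \<in> w'.R \<longleftrightarrow> (i, j) \<in> R" for i j
    using eq unfolding R by (simp add: mem_translate v)
  have "(0, 0) \<in> R" "(0, 0) \<in> w'.R"
    by (auto simp: mem_region p_0 q_0 w'.p_0 w'.q_0 intro!: exI[of _ 0])
  \<comment> \<open>Both regions contain the origin and only nonnegative contents, so
    \<open>b - a\<close> and \<open>a - b\<close> are nonnegative. The origin is the only cell of
    content \<open>0\<close>, hence the shift is zero.\<close>
  then have "(a, b) \<in> w'.R" "(- a, - b) \<in> R"
    using mem[of 0 0] mem[of "- a" "- b"] by simp_all
  then have "a = b" by (auto simp: mem_region)
  with \<open>(a, b) \<in> w'.R\<close> have "a = 0"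
    by (auto simp: mem_region w'.p_0 w'.q_0)
  have "w'.R = R"
    using mem \<open>a = b\<close> \<open>a = 0\<close> by (auto simp: set_eq_iff)
  have "p' c = p c \<and> q' c = q c" if "c \<le> m" for c
  proof -
    have "p' c \<le> i \<and> i \<le> q' c \<longleftrightarrow> p c \<le> i \<and> i \<le> q c" for i
      using mem_region_diagonal[of i c m p q] mem_region_diagonal[of i c m p' q'] that
      unfolding \<open>w'.R = R\<close> by simp
    \<comment> \<open>Nonempty intervals with the same elements have the same ends.\<close>
    from this[of "p c"] this[of "q c"] this[of "p' c"] this[of "q' c"] show ?thesis
      using p_le_q[OF that] w'.p_le_q[OF that] by simp
  qed
  then have step: "word_height fst w' c = word_height fst w c"
    "word_height snd w' c = word_height snd w c" if "c \<le> length w" for c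
    using that by (simp_all add: m_def p_def q_def p'_def q'_def)
  show "w' = w"
  proof (rule nth_equalityI)
    fix c assume "c < length w'"
    then have c: "c < length w" by (simp add: len)
    have "fst (w' ! c) = fst (w ! c)" "snd (w' ! c) = snd (w ! c)"
      using step[of c] step[of "Suc c"] c by (simp_all add: word_height_Suc len split: if_splits)
    then show "w' ! c = w ! c" by (rule prod_eqI)
  qed (rule len)
qed

lemma word_region_props:
  assumes "motzkin_from 0 w"
  shows "edge_connected (word_region w)" "perimeter (word_region w) = 2 * (length w + 2)"
    "skew_rank (word_region w) = 1 + int (ups w)"
    "\<exists>v. is_skew_diagram ((+) v ` word_region w)"
proof -
  interpret staircase "length w" "word_height fst w" "word_height snd w"
    using assms by (simp add: staircase_word_iff)
  have R: "word_region w = R" by (simp add: word_region_def)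
  show "edge_connected (word_region w)" "perimeter (word_region w) = 2 * (length w + 2)"
    "skew_rank (word_region w) = 1 + int (ups w)"
    unfolding R ups_eq_card
    by (rule edge_connected_region perimeter_region skew_rank_region)+
  \<comment> \<open>Moves the topmost row and the leftmost column, which is \<open>0\<close>, to
    \<open>1\<close>.\<close>
  define v :: cell where "v = (1 - word_height fst w (length w), 1)"
  have "is_skew_diagram ((+) v ` word_region w)"
    unfolding R
  proof (rule order_convex_is_skew_diagram)
    show "order_convex ((+) v ` R)"
      by (rule order_convex_translate[OF order_convex_region])
    show "1 \<le> i \<and> 1 \<le> j" if "(i, j) \<in> (+) v ` R" for i j
      using that region_bounds[of "i - fst v" "j - snd v"] by (simp add: mem_translate v_def)
  qed (simp add: finite_region)
  then show "\<exists>v. is_skew_diagram ((+) v ` word_region w)" ..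
qed

section \<open>Counting the translation classes\<close>

lemma translation_relI: "(S, (+) v ` S) \<in> translation_rel"
  unfolding translation_rel_def by blast

text \<open>The perimeter determines the length of the word and the rank its number of ups;
  conversely a translate of each word region into the positive quadrant represents its
  class.\<close>

lemma parallelogram_polyominoes_eq:
  assumes "r \<ge> 1"
  shows "parallelogram_polyominoes (2 * (m + 2)) (int r) =
    (\<lambda>w. translation_rel `` {word_region w}) ` motzkin_words m 0 (r - 1)"
proof (intro equalityI subsetI)
  fix X assume "X \<in> parallelogram_polyominoes (2 * (m + 2)) (int r)"
  then obtain T where T: "X = translation_rel `` {T}" "is_skew_diagram T" "edge_connected T"
    "perimeter T = 2 * (m + 2)" "skew_rank T = int r"
    unfolding parallelogram_polyominoes_def by (auto elim!: quotientE)
  obtain m' p q v where st: "staircase m' p q" and TR: "T = (+) v ` region m' p q"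
    using connected_order_convex_is_region skew_diagram_finite skew_diagram_order_convex T by metis
  obtain w where w: "motzkin_from 0 w" "T = (+) v ` word_region w"
    using staircase_word[OF st] TR by metis
  have "length w = m" "ups w = r - 1"
    using T(4,5) word_region_props(2,3)[OF w(1)]
    by (simp_all add: w(2) perimeter_translate skew_rank_translate)
  then have "w \<in> motzkin_words m 0 (r - 1)"
    using w by (simp add: motzkin_words_def)
  moreover have "X = translation_rel `` {word_region w}"
    unfolding T(1) w(2) by (rule equiv_class_eq[OF equiv_translation_rel, OF translation_relI, symmetric])
  ultimately show "X \<in> (\<lambda>w. translation_rel `` {word_region w}) ` motzkin_words m 0 (r - 1)"
    by blast
next
  fix X assume "X \<in> (\<lambda>w. translation_rel `` {word_region w}) ` motzkin_words m 0 (r - 1)"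
  then obtain w where X: "X = translation_rel `` {word_region w}"
    and w: "motzkin_from 0 w" "length w = m" "ups w = r - 1"
    by (auto simp: motzkin_words_def)
  obtain v where v: "is_skew_diagram ((+) v ` word_region w)"
    using word_region_props(4)[OF w(1)] by blast
  have "X = translation_rel `` {(+) v ` word_region w}"
    unfolding X by (rule equiv_class_eq[OF equiv_translation_rel translation_relI])
  moreover have "edge_connected ((+) v ` word_region w)"
    "perimeter ((+) v ` word_region w) = 2 * (m + 2)" "skew_rank ((+) v ` word_region w) = int r"
    using word_region_props(1-3)[OF w(1)] w assms edge_connected_translate
    by (simp_all add: perimeter_translate skew_rank_translate)
  ultimately show "X \<in> parallelogram_polyominoes (2 * (m + 2)) (int r)"
    unfolding parallelogram_polyominoes_def using v by (auto intro: quotientI)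
qed

lemma inj_on_word_region_class:
  "inj_on (\<lambda>w. translation_rel `` {word_region w}) (motzkin_words m 0 k)"
proof (rule inj_onI)
  fix w w' assume w: "w \<in> motzkin_words m 0 k" "w' \<in> motzkin_words m 0 k"
    and eq: "translation_rel `` {word_region w} = translation_rel `` {word_region w'}"
  then have "(word_region w', word_region w) \<in> translation_rel"
    using eq_equiv_class[OF _ equiv_translation_rel] by (metis UNIV_I)
  then obtain v where "word_region w = (+) v ` word_region w'"
    unfolding translation_rel_def by blast
  then show "w = w'"
    using word_region_translate_eq[of w' w v] w by (simp add: motzkin_words_def)
qed

theorem theorem5p11:
  fixes n r :: nat
  assumes "n \<ge> 1" and "r \<ge> 1"
  shows "finite (parallelogram_polyominoes (2 * n + 2) (int r)) \<and>
    real (card (parallelogram_polyominoes (2 * n + 2) (int r))) =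
      2 powi (int n + 1 - 2 * int r) * real ((n - 1) choose (2 * r - 2)) * catalan (r - 1)"
proof -
  have "2 * n + 2 = 2 * (n - 1 + 2)" using assms by simp
  then have eq: "parallelogram_polyominoes (2 * n + 2) (int r) =
      (\<lambda>w. translation_rel `` {word_region w}) ` motzkin_words (n - 1) 0 (r - 1)"
    using parallelogram_polyominoes_eq[OF assms(2), of "n - 1"] by (simp only:)
  \<comment> \<open>Since \<open>n\<close> and \<open>r\<close> are positive, the subtractions of
    naturals are exact.\<close>
  have "int (n - 1) - 2 * int (r - 1) = int n + 1 - 2 * int r" "2 * (r - 1) = 2 * r - 2"
    using assms by auto
  then show ?thesis
    unfolding eq card_image[OF inj_on_word_region_class]
    using card_motzkin_words_0[of "n - 1" "r - 1"] by (metis finite_imageI finite_motzkin_words)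
qed

end
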